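(* For integers $0\le k\le n$, let $SD(n,k)$ be defined by $SD(n,n)=0$, $SD(n,0)=0$, and $SD(n,k)=2^{k-1}k-2^k+1+SD(n-1,k)+SD(n-1,k-1)$ for $0<k<n$. Let $S_{n,k}=\sum_{j=0}^{k}\binom{n-k+j}{j}2^{k-j}$. Then for all integers $0\le k\le n$, \[SD(n,k)=\binom{n}{k}\frac{n+1}{2}-S_{n,k}\frac{n-2k+1}{2}-2^k(k-1)-1.\]
   Context: $SD(n,k)$ is the difference between the number of comparators of the pairwise selection network of Codish and Zazon-Ivry and of the improved pairwise selection network, for $2^n$ inputs and $2^k$ selected elements; the claim is purely about the recursively defined numbers above. *)

theory Defs
  imports Complex_Main
begin

(* Only the values with k \<le> n are meaningful; for k > n the function is set to 0. *)
fun SD :: "nat \<Rightarrow> nat \<Rightarrow> int" where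
  "SD 0 k = 0"
| "SD (Suc n) k =
     (if k = 0 \<or> k \<ge> Suc n then 0
      else 2 ^ (k - 1) * int k - 2 ^ k + 1 + SD n k + SD n (k - 1))"

lemma SD_diag: "SD n n = 0"
  by (cases n) simp_all

lemma SD_zero: "SD n 0 = 0"
  by (cases n) simp_all

lemma SD_rec:
  assumes "0 < k" "k < n"
  shows "SD n k = 2 ^ (k - 1) * int k - 2 ^ k + 1 + SD (n - 1) k + SD (n - 1) (k - 1)"
  using assms by (cases n) simp_all

definition S :: "nat \<Rightarrow> nat \<Rightarrow> nat" where
  "S n k = (\<Sum>j=0..k. ((n - k + j) choose j) * 2 ^ (k - j))"

end

theory Submission
  imports Defs
begin

text \<open>The sum \<open>S n k\<close> is the partial row sum \<open>\<Sum>i\<le>k. (n + 1) choose i\<close> of Pascal's triangle.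
  Hence \<open>S\<close> obeys Pascal's rule, and \<open>S n k - S n (k - 1) = (n + 1) choose k\<close>; with these two
  rules the closed form satisfies the recurrence of \<open>SD\<close>.\<close>

lemma sum_choose_atMost_Suc:
  "(\<Sum>i\<le>Suc k. Suc n choose i) = (\<Sum>i\<le>Suc k. n choose i) + (\<Sum>i\<le>k. n choose i)"
  by (induction k) simp_all

text \<open>Fixing \<open>m\<close>, which stands for \<open>n - k\<close>, makes induction on
  \<open>k\<close> work: passing to \<open>Suc k\<close> doubles the old sum and adds one binomial,
  and Pascal's rule does the same to the partial row sum.\<close>

lemma sum_choose_diagonal_power2:
  "(\<Sum>j=0..k. ((m + j) choose j) * 2 ^ (k - j)) = (\<Sum>i\<le>k. Suc (m + k) choose i)"
proof (induction k)
  case (Suc k)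
  have "(\<Sum>j=0..k. ((m + j) choose j) * 2 ^ (Suc k - j))
      = 2 * (\<Sum>j=0..k. ((m + j) choose j) * 2 ^ (k - j))"
    by (simp add: sum_distrib_left Suc_diff_le mult_ac)
  with Suc show ?case
    using sum_choose_atMost_Suc[of "Suc (m + k)" k] by simp
qed simp

lemma S_eq_sum_choose:
  assumes "k \<le> n"
  shows "S n k = (\<Sum>i\<le>k. Suc n choose i)"
  using sum_choose_diagonal_power2[of "n - k" k] assms by (simp add: S_def)

lemma S_Suc_Suc:
  assumes "Suc k \<le> n"
  shows "S (Suc n) (Suc k) = S n (Suc k) + S n k"
  using assms sum_choose_atMost_Suc[of "Suc n" k] by (simp add: S_eq_sum_choose)

lemma S_Suc_right:
  assumes "Suc k \<le> n"
  shows "S n (Suc k) = S n k + (Suc n choose Suc k)"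
  using assms by (simp add: S_eq_sum_choose)

text \<open>Row \<open>Suc n\<close> lacks only its last entry 1 here.\<close>

lemma S_diag: "real (S n n) = 2 * 2 ^ n - 1"
proof -
  have "S n n + 1 = 2 ^ Suc n"
    using choose_row_sum[of "Suc n"] by (simp add: S_eq_sum_choose)
  then show ?thesis
    by (metis add_diff_cancel_right' of_nat_1 of_nat_add of_nat_numeral of_nat_power power_Suc)
qed

theorem theorem5:
  fixes n k :: nat
  assumes "k \<le> n"
  shows "real_of_int (SD n k) =
    real (n choose k) * ((real n + 1) / 2)
    - real (S n k) * ((real n - 2 * real k + 1) / 2)
    - 2 ^ k * (real k - 1) - 1"
  using assms
proof (induction n arbitrary: k)
  case 0
  then show ?case by (simp add: S_def)
next
  case (Suc n)
  consider "k = 0" | "k = Suc n" | j where "k = Suc j" "Suc j \<le> n"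
    using Suc.prems by (cases k) force+
  then show ?case
  proof cases
    case 1
    then show ?thesis by (simp add: S_def)
  next
    case 2
    then show ?thesis
      by (simp only: SD_diag S_diag) (simp add: field_simps)
  next
    case 3
    \<comment> \<open>The bound \<open>Suc j \<le> n\<close> makes both induction hypotheses
      available.\<close>
    have "SD (Suc n) k = 2 ^ j * int (Suc j) - 2 ^ Suc j + 1 + SD n (Suc j) + SD n j"
      using 3 by simp
    moreover have "real (Suc n choose Suc j) = real (n choose Suc j) + real (n choose j)"
      by simp
    moreover have "real (S n (Suc j)) = real (S n j) + real (Suc n choose Suc j)"
      using S_Suc_right[OF 3(2)] by simp
    moreover have "real (S (Suc n) (Suc j)) = real (S n (Suc j)) + real (S n j)"
      using S_Suc_Suc[OF 3(2)] by simp
    ultimately show ?thesis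
      using Suc.IH[of j] Suc.IH[of "Suc j"] 3
      \<comment> \<open>The deleted rules would dissolve the collected equations. In terms of
        \<open>S n j\<close> and \<open>Suc n choose Suc j\<close>, the closed form reduces to a
        linear identity in these two.\<close>
      by (simp del: binomial_Suc_Suc SD.simps) (simp add: field_simps)
  qed
qed

end
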